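(* Let $\alpha=(b_{0,0},b_{0,1},b_{1,1},b_{1,2},b_{1,4})\in\mathbb{C}^5$ and $\alpha'=(b_{0,0}',b_{0,1}',b_{1,1}',b_{1,2}',b_{1,4}')\in\mathbb{C}^5$. The algebras $L(\alpha)$ and $L(\alpha')$ from $CE(\mu_6)$ are isomorphic if and only if there exist $A_0,A_1,B_1,B_2,B_3\in\mathbb{C}$ with $A_0B_1\neq0$ such that $$b_{0,0}'=\frac{A_0^2b_{0,0}+A_0A_1b_{0,1}+A_1^2b_{1,1}}{A_0^{5}B_1},\qquad b_{1,1}'=\frac{B_1b_{1,1}}{A_0^{5}},\qquad b_{0,1}'=\frac{A_0b_{0,1}+2A_1b_{1,1}}{A_0^{5}},$$ $$b_{1,2}'=\frac{1}{A_0^4B_1}\left(B_1^2b_{1,2}+(2B_1B_3-B_2^2)b_{1,4}\right),\qquad b_{1,4}'=\frac{B_1}{A_0^2}b_{1,4}.$$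
   Context: A Leibniz algebra over $\mathbb{C}$ is a complex vector space with a bilinear bracket satisfying $[x,[y,z]]=[[x,y],z]-[[x,z],y]$. $CE(\mu_6)$ (one-dimensional Leibniz central extensions of the 6-dimensional naturally graded filiform Lie algebra $\mu_6$) is the class of the 7-dimensional complex Leibniz algebras $L(\alpha)$, $\alpha=(b_{0,0},b_{0,1},b_{1,1},b_{1,2},b_{1,4})\in\mathbb{C}^5$, with basis $e_0,\dots,e_6$ and brackets $[e_i,e_0]=e_{i+1}$ ($1\le i\le 5$), $[e_0,e_i]=-e_{i+1}$ ($2\le i\le 5$), $[e_0,e_0]=b_{0,0}e_6$, $[e_0,e_1]=-e_2+b_{0,1}e_6$, $[e_1,e_1]=b_{1,1}e_6$, $[e_1,e_2]=-[e_2,e_1]=b_{1,2}e_6$, $[e_1,e_4]=-[e_4,e_1]=b_{1,4}e_6$, $[e_2,e_3]=-[e_3,e_2]=-b_{1,4}e_6$, all other brackets of basis vectors being zero. Isomorphic means isomorphic as Leibniz algebras. *)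

theory Defs
  imports "HOL-Analysis.Analysis"
begin

locale leibniz_algebra = vector_space scale
  for scale :: "complex \<Rightarrow> 'a::ab_group_add \<Rightarrow> 'a" +
  fixes bracket :: "'a \<Rightarrow> 'a \<Rightarrow> 'a"
  assumes linear_left: "Vector_Spaces.linear scale scale (\<lambda>x. bracket x y)"
    and linear_right: "Vector_Spaces.linear scale scale (\<lambda>y. bracket x y)"
    and leibniz_identity:
      "bracket x (bracket y z) = bracket (bracket x y) z - bracket (bracket x z) y"

definition leibniz_isomorphic ::
  "(complex \<Rightarrow> 'a::ab_group_add \<Rightarrow> 'a) \<Rightarrow> ('a \<Rightarrow> 'a \<Rightarrow> 'a) \<Rightarrow>
   (complex \<Rightarrow> 'b::ab_group_add \<Rightarrow> 'b) \<Rightarrow> ('b \<Rightarrow> 'b \<Rightarrow> 'b) \<Rightarrow> bool"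
  where "leibniz_isomorphic s1 br1 s2 br2 \<longleftrightarrow>
    (\<exists>f. Vector_Spaces.linear s1 s2 f \<and> bij f \<and> (\<forall>x y. f (br1 x y) = br2 (f x) (f y)))"

text \<open>Indices live in the seven-element type \<open>7\<close>, where \<open>of_nat\<close> reduces modulo 7;
  \<open>basis_vec i\<close> is meant for \<open>i \<le> 6\<close> only.\<close>

definition basis_vec :: "nat \<Rightarrow> complex ^ 7"
  where "basis_vec i = axis (of_nat i) 1"

definition ce_mu6_table ::
  "complex \<Rightarrow> complex \<Rightarrow> complex \<Rightarrow> complex \<Rightarrow> complex \<Rightarrow> nat \<Rightarrow> nat \<Rightarrow> complex ^ 7"
  where "ce_mu6_table b00 b01 b11 b12 b14 i j =
    (if 1 \<le> i \<and> i \<le> 5 \<and> j = 0 then basis_vec (i + 1)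
     else if i = 0 \<and> 2 \<le> j \<and> j \<le> 5 then - basis_vec (j + 1)
     else if (i, j) = (0, 0) then b00 *s basis_vec 6
     else if (i, j) = (0, 1) then - basis_vec 2 + b01 *s basis_vec 6
     else if (i, j) = (1, 1) then b11 *s basis_vec 6
     else if (i, j) = (1, 2) then b12 *s basis_vec 6
     else if (i, j) = (2, 1) then - (b12 *s basis_vec 6)
     else if (i, j) = (1, 4) then b14 *s basis_vec 6
     else if (i, j) = (4, 1) then - (b14 *s basis_vec 6)
     else if (i, j) = (2, 3) then - (b14 *s basis_vec 6)
     else if (i, j) = (3, 2) then b14 *s basis_vec 6
     else 0)"

definition ce_mu6_bracket ::
  "complex \<Rightarrow> complex \<Rightarrow> complex \<Rightarrow> complex \<Rightarrow> complex \<Rightarrow>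
   complex ^ 7 \<Rightarrow> complex ^ 7 \<Rightarrow> complex ^ 7"
  where "ce_mu6_bracket b00 b01 b11 b12 b14 x y =
    (\<Sum>i\<le>6. \<Sum>j\<le>6. (x $ of_nat i * y $ of_nat j) *s ce_mu6_table b00 b01 b11 b12 b14 i j)"


lemma UNIV_7: "(UNIV :: 7 set) = {0, 1, 2, 3, 4, 5, 6}"
proof -
  have "card {0, 1, 2, 3, 4, 5, 6 :: 7} = CARD(7)"
    by simp
  then show ?thesis
    by (metis card_subset_eq finite subset_UNIV)
qed

lemma forall_7: "(\<forall>i::7. P i) \<longleftrightarrow> P 0 \<and> P 1 \<and> P 2 \<and> P 3 \<and> P 4 \<and> P 5 \<and> P 6"
proof -
  have "(\<forall>i::7. P i) \<longleftrightarrow> (\<forall>i\<in>UNIV. P i)" by simp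
  then show ?thesis unfolding UNIV_7 by simp
qed

lemma atMost_6: "{..6::nat} = {0, 1, 2, 3, 4, 5, 6}"
  by auto

lemma ce_mu6_bracket_component:
  fixes x y :: "complex ^ 7" and b00 b01 b11 b12 b14 :: complex
  defines "z \<equiv> ce_mu6_bracket b00 b01 b11 b12 b14 x y"
  shows "z $ 0 = 0" "z $ 1 = 0"
    "z $ 2 = x $ 1 * y $ 0 - x $ 0 * y $ 1"
    "z $ 3 = x $ 2 * y $ 0 - x $ 0 * y $ 2"
    "z $ 4 = x $ 3 * y $ 0 - x $ 0 * y $ 3"
    "z $ 5 = x $ 4 * y $ 0 - x $ 0 * y $ 4"
    "z $ 6 = x $ 5 * y $ 0 - x $ 0 * y $ 5 + b00 * x $ 0 * y $ 0 + b01 * x $ 0 * y $ 1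
       + b11 * x $ 1 * y $ 1 + b12 * (x $ 1 * y $ 2 - x $ 2 * y $ 1)
       + b14 * (x $ 1 * y $ 4 - x $ 4 * y $ 1 - x $ 2 * y $ 3 + x $ 3 * y $ 2)"
  by (simp_all add: z_def ce_mu6_bracket_def atMost_6 ce_mu6_table_def basis_vec_def axis_def
      algebra_simps)

lemma ce_mu6_bracket_basis:
  assumes "i \<le> 6" "j \<le> 6"
  shows "ce_mu6_bracket b00 b01 b11 b12 b14 (basis_vec i) (basis_vec j)
           = ce_mu6_table b00 b01 b11 b12 b14 i j"
proof -
  have "i \<in> {..6}" "j \<in> {..6}" using assms by auto
  then show ?thesis
    unfolding atMost_6
    by (elim insertE emptyE)
      (simp_all add: vec_eq_iff forall_7 ce_mu6_bracket_component ce_mu6_table_def basis_vec_def axis_def)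
qed

lemma leibniz_algebra_ce_mu6:
  "leibniz_algebra (*s) (ce_mu6_bracket b00 b01 b11 b12 b14)"
proof -
  have "vector_space ((*s) :: complex \<Rightarrow> complex ^ 7 \<Rightarrow> complex ^ 7)" ..
  then show ?thesis
    by (simp add: leibniz_algebra_def leibniz_algebra_axioms_def Vector_Spaces.linear_iff
        vec_eq_iff forall_7 ce_mu6_bracket_component algebra_simps)
qed

end

theory Submission
  imports Defs
begin

text \<open>An isomorphism \<open>L(\<alpha>') \<rightarrow> L(\<alpha>)\<close> is determined by the images \<open>p 0 = \<Sum> A_i e_i\<close> and
  \<open>p 1 = \<Sum> B_i e_i\<close> of the generators \<open>e_0\<close> and \<open>e_1\<close>, since \<open>e_{i+1} = [e_i, e_0]\<close> for
  \<open>1 \<le> i \<le> 5\<close>.  The image of \<open>e_6\<close> is \<open>A_0^4 (A_0 B_1 - A_1 B_0) e_6\<close>, so this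
  coefficient is nonzero, and \<open>[e_1, e_5] = 0\<close> then forces \<open>B_0 = 0\<close>.  The remaining relations
  read off the new parameters.  They involve only \<open>A_0, A_1, B_1, B_2, B_3\<close>, so for the converse all
  other coefficients of \<open>p 0\<close> and \<open>p 1\<close> are taken to be zero.\<close>

text \<open>The primed parameters are read off from a map out of the primed algebra, whereas the
  theorem speaks of a map into it; inverting the map bridges the two.\<close>

lemma leibniz_isomorphic_sym:
  assumes "leibniz_isomorphic s1 br1 s2 br2"
  shows "leibniz_isomorphic s2 br2 s1 br1"
proof -
  obtain f where lin: "Vector_Spaces.linear s1 s2 f" and bij: "bij f"
    and hom: "\<And>x y. f (br1 x y) = br2 (f x) (f y)"
    using assms unfolding leibniz_isomorphic_def by blast
  define g where "g = inv f"
  have fg: "f (g y) = y" for y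
    using bij by (simp add: g_def bij_is_surj surj_f_inv_f)
  have gI: "g y = x" if "y = f x" for x y
    using bij that by (simp add: g_def bij_is_inj)
  have "Vector_Spaces.linear s2 s1 g"
    using lin unfolding Vector_Spaces.linear_iff by (auto intro!: gI simp: fg)
  moreover have "bij g"
    using bij by (simp add: g_def bij_imp_bij_inv)
  moreover have "g (br2 x y) = br1 (g x) (g y)" for x y
    by (rule gI) (simp add: hom fg)
  ultimately show ?thesis
    unfolding leibniz_isomorphic_def by blast
qed

lemma ce_mu6_isomorphic_imp_parameters:
  assumes "leibniz_isomorphic (*s) (ce_mu6_bracket b00' b01' b11' b12' b14')
             (*s) (ce_mu6_bracket b00 b01 b11 b12 b14)"
  obtains A0 A1 B1 B2 B3 where "A0 * B1 \<noteq> 0"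
    "A0^5 * B1 * b00' = A0^2 * b00 + A0 * A1 * b01 + A1^2 * b11"
    "A0^5 * B1 * b11' = B1^2 * b11"
    "A0^5 * B1 * b01' = A0 * B1 * b01 + 2 * A1 * B1 * b11"
    "A0^5 * B1 * b12' = A0 * (B1^2 * b12 + (2 * B1 * B3 - B2^2) * b14)"
    "A0^5 * B1 * b14' = A0^3 * B1^2 * b14"
proof -
  let ?br = "ce_mu6_bracket b00 b01 b11 b12 b14"
  obtain g :: "complex ^ 7 \<Rightarrow> complex ^ 7"
    where lin: "Vector_Spaces.linear (*s) (*s) g" and bij: "bij g"
    and hom: "\<And>x y. g (ce_mu6_bracket b00' b01' b11' b12' b14' x y) = ?br (g x) (g y)"
    using assms unfolding leibniz_isomorphic_def by blast
  interpret g: Vector_Spaces.linear "(*s)" "(*s)" g by (fact lin)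
  define p where "p i = g (basis_vec i)" for i
  have table: "?br (p i) (p j) = g (ce_mu6_table b00' b01' b11' b12' b14' i j)"
    if "i \<le> 6" "j \<le> 6" for i j
    using that by (simp add: p_def hom[symmetric] ce_mu6_bracket_basis)
  note table_simps = table ce_mu6_table_def g.scale g.neg g.add g.zero p_def[symmetric]
  note comp = ce_mu6_bracket_component
  have p_Suc: "p 2 = ?br (p 1) (p 0)" "p 3 = ?br (p 2) (p 0)" "p 4 = ?br (p 3) (p 0)"
    "p 5 = ?br (p 4) (p 0)" "p 6 = ?br (p 5) (p 0)"
    by (simp_all add: table_simps numeral_2_eq_2[symmetric])
  define A where "A = ($) (p 0)"
  define B where "B = ($) (p 1)"
  have A: "p 0 $ i = A i" and B: "p (Suc 0) $ i = B i" for i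
    by (simp_all add: A_def B_def)
  \<comment> \<open>\<open>D\<close> is the \<open>e_2\<close> coordinate of the image of
    \<open>e_2\<close>. Each further bracket with \<open>p 0\<close> shifts the leading term by one
    index and multiplies it by \<open>A 0\<close>.\<close>
  define D where "D = B 1 * A 0 - B 0 * A 1"
  have p2: "p 2 $ 0 = 0" "p 2 $ 1 = 0" "p 2 $ 2 = D"
    unfolding p_Suc(1) by (simp_all add: comp A B D_def)
  have p3: "p 3 $ 0 = 0" "p 3 $ 1 = 0" "p 3 $ 2 = 0" "p 3 $ 3 = D * A 0"
    unfolding p_Suc(2) by (simp_all add: comp A p2)
  have p4: "p 4 $ 0 = 0" "p 4 $ 1 = 0" "p 4 $ 2 = 0" "p 4 $ 3 = 0" "p 4 $ 4 = D * A 0 ^ 2"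
    unfolding p_Suc(3) by (simp_all add: comp A p3 power2_eq_square)
  have p5: "p 5 $ 0 = 0" "p 5 $ 1 = 0" "p 5 $ 2 = 0" "p 5 $ 3 = 0" "p 5 $ 4 = 0"
    "p 5 $ 5 = D * A 0 ^ 3"
    unfolding p_Suc(4) by (simp_all add: comp A p4 power_numeral_reduce)
  have p6: "p 6 $ 0 = 0" "p 6 $ 1 = 0" "p 6 $ 2 = 0" "p 6 $ 3 = 0" "p 6 $ 4 = 0" "p 6 $ 5 = 0"
    "p 6 $ 6 = D * A 0 ^ 4"
    unfolding p_Suc(5) by (simp_all add: comp A p5 power_numeral_reduce)
  have "p 6 \<noteq> 0"
  proof
    assume "p 6 = 0"
    then have "basis_vec 6 = 0"
      using bij g.zero unfolding p_def by (metis bij_is_inj injD)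
    then show False
      by (simp add: basis_vec_def axis_eq_0_iff)
  qed
  then have nz: "D \<noteq> 0" "A 0 \<noteq> 0"
    by (auto simp: vec_eq_iff forall_7 p6)
  \<comment> \<open>This coordinate also equals \<open>- B 0 * D * A 0 ^ 3\<close>.\<close>
  have "?br (p 1) (p 5) $ 6 = 0"
    by (simp add: table_simps)
  then have B0: "B 0 = 0"
    using nz by (simp add: comp B p5)
  have D: "D = B 1 * A 0"
    by (simp add: D_def B0)
  \<comment> \<open>Through the \<open>b14\<close> terms of \<open>?br (p 1) (p 2)\<close>, these
    non-leading coordinates produce \<open>2 * B1 * B3 - B2^2\<close>.\<close>
  have p2': "p 2 $ 3 = B 2 * A 0" "p 2 $ 4 = B 3 * A 0"
    unfolding p_Suc(1) by (simp_all add: comp A B B0)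
  show thesis
  \<comment> \<open>The witnesses are listed in the order in which the variables first occur in the
    equations.\<close>
  proof (rule that[of "A 0" "B 1" "A 1" "B 3" "B 2"])
    show "A 0 * B 1 \<noteq> 0"
      using nz by (simp add: D)
    have "b00' * p 6 $ 6 = ?br (p 0) (p 0) $ 6"
      by (simp add: table_simps)
    then show "A 0 ^ 5 * B 1 * b00' = A 0 ^ 2 * b00 + A 0 * A 1 * b01 + A 1 ^ 2 * b11"
      by (simp add: comp A p6 D power_numeral_reduce algebra_simps)
    have "b11' * p 6 $ 6 = ?br (p 1) (p 1) $ 6"
      by (simp add: table_simps)
    then show "A 0 ^ 5 * B 1 * b11' = B 1 ^ 2 * b11"
      by (simp add: comp B B0 p6 D power_numeral_reduce algebra_simps)
    \<comment> \<open>Adding the two brackets cancels the images of \<open>- e_2\<close> and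
      \<open>e_2\<close>.\<close>
    have "b01' * p 6 $ 6 = ?br (p 0) (p 1) $ 6 + ?br (p 1) (p 0) $ 6"
      by (simp add: table_simps g.diff numeral_2_eq_2[symmetric])
    then show "A 0 ^ 5 * B 1 * b01' = A 0 * B 1 * b01 + 2 * A 1 * B 1 * b11"
      by (simp add: comp A B B0 p6 D power_numeral_reduce algebra_simps)
    have "b12' * p 6 $ 6 = ?br (p 1) (p 2) $ 6"
      by (simp add: table_simps)
    then show "A 0 ^ 5 * B 1 * b12' = A 0 * (B 1 ^ 2 * b12 + (2 * B 1 * B 3 - B 2 ^ 2) * b14)"
      by (simp add: comp B B0 p2 p2' p6 D power_numeral_reduce algebra_simps)
    have "b14' * p 6 $ 6 = ?br (p 1) (p 4) $ 6"
      by (simp add: table_simps)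
    then show "A 0 ^ 5 * B 1 * b14' = A 0 ^ 3 * B 1 ^ 2 * b14"
      by (simp add: comp B B0 p4 p6 D power_numeral_reduce algebra_simps)
  qed
qed

lemma parameters_imp_ce_mu6_isomorphic:
  assumes nz: "A0 * B1 \<noteq> 0"
    and b00: "A0^5 * B1 * b00' = A0^2 * b00 + A0 * A1 * b01 + A1^2 * b11"
    and b11: "A0^5 * B1 * b11' = B1^2 * b11"
    and b01: "A0^5 * B1 * b01' = A0 * B1 * b01 + 2 * A1 * B1 * b11"
    and b12: "A0^5 * B1 * b12' = A0 * (B1^2 * b12 + (2 * B1 * B3 - B2^2) * b14)"
    and b14: "A0^5 * B1 * b14' = A0^3 * B1^2 * b14"
  shows "leibniz_isomorphic (*s) (ce_mu6_bracket b00' b01' b11' b12' b14')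
           (*s) (ce_mu6_bracket b00 b01 b11 b12 b14)"
proof -
  \<comment> \<open>The columns are the iterated brackets of \<open>A0 e_0 + A1 e_1\<close> and \<open>B1 e_1 + B2 e_2 + B3 e_3\<close>
    in the second algebra.\<close>
  define g :: "complex ^ 7 \<Rightarrow> complex ^ 7" where "g x = (\<chi> i.
     if i = 0 then A0 * x $ 0
     else if i = 1 then A1 * x $ 0 + B1 * x $ 1
     else if i = 2 then B2 * x $ 1 + A0 * B1 * x $ 2
     else if i = 3 then B3 * x $ 1 + A0 * B2 * x $ 2 + A0^2 * B1 * x $ 3
     else if i = 4 then A0 * B3 * x $ 2 + A0^2 * B2 * x $ 3 + A0^3 * B1 * x $ 4
     else if i = 5 then A0^2 * B3 * x $ 3 + A0^3 * B2 * x $ 4 + A0^4 * B1 * x $ 5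
     else (b11 * B1 * A1 - b12 * B2 * A1) * x $ 2
        - (b12 * A0 * B1 * A1 + b14 * A0 * B3 * A1) * x $ 3
        + (A0^3 * B3 - b14 * A0^2 * B2 * A1) * x $ 4
        + (A0^4 * B2 - b14 * A0^3 * B1 * A1) * x $ 5 + A0^5 * B1 * x $ 6)" for x
  have g: "g x $ 0 = A0 * x $ 0"
    "g x $ 1 = A1 * x $ 0 + B1 * x $ 1"
    "g x $ 2 = B2 * x $ 1 + A0 * B1 * x $ 2"
    "g x $ 3 = B3 * x $ 1 + A0 * B2 * x $ 2 + A0^2 * B1 * x $ 3"
    "g x $ 4 = A0 * B3 * x $ 2 + A0^2 * B2 * x $ 3 + A0^3 * B1 * x $ 4"
    "g x $ 5 = A0^2 * B3 * x $ 3 + A0^3 * B2 * x $ 4 + A0^4 * B1 * x $ 5"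
    "g x $ 6 = (b11 * B1 * A1 - b12 * B2 * A1) * x $ 2
        - (b12 * A0 * B1 * A1 + b14 * A0 * B3 * A1) * x $ 3
        + (A0^3 * B3 - b14 * A0^2 * B2 * A1) * x $ 4
        + (A0^4 * B2 - b14 * A0^3 * B1 * A1) * x $ 5 + A0^5 * B1 * x $ 6" for x
    by (simp_all add: g_def)
  have lin: "Vector_Spaces.linear (*s) (*s) g"
    unfolding Vector_Spaces.linear_iff
    by (simp add: vec.vector_space_axioms vec_eq_iff forall_7 g algebra_simps)
  interpret g: Vector_Spaces.linear "(*s)" "(*s)" g by (fact lin)
  \<comment> \<open>The matrix of \<open>g\<close> is lower triangular, with diagonal
    \<open>A0\<close> followed by \<open>A0^k * B1\<close> for k from 0 to 5.\<close>
  have "x = 0" if "g x = 0" for x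
  proof -
    have "g x $ i = 0" for i
      using that by simp
    note eqs = this[of 0] this[of 1] this[of 2] this[of 3] this[of 4] this[of 5] this[of 6]
    show ?thesis
      using eqs nz by (auto simp: g vec_eq_iff forall_7)
  qed
  then have inj: "inj g"
    by (simp add: g.inj_iff_eq_0)
  then have bij: "bij g"
    using vec.linear_inj_imp_surj[OF lin] by (simp add: bij_def)
  have hom: "g (ce_mu6_bracket b00' b01' b11' b12' b14' x y)
      = ce_mu6_bracket b00 b01 b11 b12 b14 (g x) (g y)" (is "g ?z = ?w") for x y
  proof -
    note comp = ce_mu6_bracket_component
    \<comment> \<open>Only this coordinate involves the parameters. Every primed one is displayed
      with the factor \<open>A0^5 * B1\<close>, so that the hypotheses eliminate it and a polynomial
      identity remains.\<close>
    have "g ?z $ 6 = (b11 * B1 * A1 - b12 * B2 * A1) * ?z $ 2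
        - (b12 * A0 * B1 * A1 + b14 * A0 * B3 * A1) * ?z $ 3
        + (A0^3 * B3 - b14 * A0^2 * B2 * A1) * ?z $ 4
        + (A0^4 * B2 - b14 * A0^3 * B1 * A1) * ?z $ 5
        + (A0^5 * B1 * (x $ 5 * y $ 0 - x $ 0 * y $ 5)
          + A0^5 * B1 * b00' * x $ 0 * y $ 0 + A0^5 * B1 * b01' * x $ 0 * y $ 1
          + A0^5 * B1 * b11' * x $ 1 * y $ 1
          + A0^5 * B1 * b12' * (x $ 1 * y $ 2 - x $ 2 * y $ 1)
          + A0^5 * B1 * b14' * (x $ 1 * y $ 4 - x $ 4 * y $ 1 - x $ 2 * y $ 3 + x $ 3 * y $ 2))"
      unfolding g(7) comp(7) by (simp add: distrib_left mult.assoc)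
    also have "\<dots> = ?w $ 6"
      unfolding b00 b01 b11 b12 b14 comp g by algebra
    finally have "g ?z $ 6 = ?w $ 6" .
    moreover have "g ?z $ 0 = ?w $ 0" "g ?z $ 1 = ?w $ 1" "g ?z $ 2 = ?w $ 2" "g ?z $ 3 = ?w $ 3"
      "g ?z $ 4 = ?w $ 4" "g ?z $ 5 = ?w $ 5"
      by (simp_all add: g comp eval_nat_numeral algebra_simps)
    ultimately show ?thesis
      unfolding vec_eq_iff forall_7 by blast
  qed
  show ?thesis
    unfolding leibniz_isomorphic_def using lin bij hom by blast
qed

theorem theorem3p3:
  fixes b00 b01 b11 b12 b14 b00' b01' b11' b12' b14' :: complex
  shows "leibniz_isomorphic (*s) (ce_mu6_bracket b00 b01 b11 b12 b14)
           (*s) (ce_mu6_bracket b00' b01' b11' b12' b14') \<longleftrightarrow>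
    (\<exists>A0 A1 B1 B2 B3 :: complex. A0 * B1 \<noteq> 0 \<and>
       b00' = (A0^2 * b00 + A0 * A1 * b01 + A1^2 * b11) / (A0^5 * B1) \<and>
       b11' = B1 * b11 / A0^5 \<and>
       b01' = (A0 * b01 + 2 * A1 * b11) / A0^5 \<and>
       b12' = 1 / (A0^4 * B1) * (B1^2 * b12 + (2 * B1 * B3 - B2^2) * b14) \<and>
       b14' = B1 / A0^2 * b14)"
    (is "?iso \<longleftrightarrow> (\<exists>A0 A1 B1 B2 B3. ?P A0 A1 B1 B2 B3)")
proof -
  have P_iff: "?P A0 A1 B1 B2 B3 \<longleftrightarrow> A0 * B1 \<noteq> 0 \<and>
       A0^5 * B1 * b00' = A0^2 * b00 + A0 * A1 * b01 + A1^2 * b11 \<and>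
       A0^5 * B1 * b11' = B1^2 * b11 \<and>
       A0^5 * B1 * b01' = A0 * B1 * b01 + 2 * A1 * B1 * b11 \<and>
       A0^5 * B1 * b12' = A0 * (B1^2 * b12 + (2 * B1 * B3 - B2^2) * b14) \<and>
       A0^5 * B1 * b14' = A0^3 * B1^2 * b14" for A0 A1 B1 B2 B3
  proof (cases "A0 * B1 = 0")
    case False
    then have nz: "A0 \<noteq> 0" "B1 \<noteq> 0" by auto
    \<comment> \<open>One common factor clears all the denominators, even the smaller ones.\<close>
    have eq_iff: "u = v \<longleftrightarrow> A0^5 * B1 * u = A0^5 * B1 * v" for u v
      using nz by simp
    have "A0^5 * B1 * ((A0^2 * b00 + A0 * A1 * b01 + A1^2 * b11) / (A0^5 * B1))
        = A0^2 * b00 + A0 * A1 * b01 + A1^2 * b11"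
      "A0^5 * B1 * (B1 * b11 / A0^5) = B1^2 * b11"
      "A0^5 * B1 * ((A0 * b01 + 2 * A1 * b11) / A0^5) = A0 * B1 * b01 + 2 * A1 * B1 * b11"
      "A0^5 * B1 * (1 / (A0^4 * B1) * (B1^2 * b12 + (2 * B1 * B3 - B2^2) * b14))
        = A0 * (B1^2 * b12 + (2 * B1 * B3 - B2^2) * b14)"
      "A0^5 * B1 * (B1 / A0^2 * b14) = A0^3 * B1^2 * b14"
      using nz by (simp_all add: field_simps eval_nat_numeral)
    then show ?thesis
      using False eq_iff by metis
  qed simp
  show ?thesis
    unfolding P_iff
    by (meson leibniz_isomorphic_sym ce_mu6_isomorphic_imp_parameters
        parameters_imp_ce_mu6_isomorphic)
qed

end
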